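(* Any $G_{\delta\sigma}$ ideal $\mathcal J$ on $\omega$ is extendable to an $F_\sigma$ ideal, i.e. there is an $F_\sigma$ ideal $\mathcal J'$ on $\omega$ with $\mathcal J\subseteq\mathcal J'$.
   Context: An ideal on $\omega$ is a family of subsets of $\omega$ closed under finite unions and subsets, containing all finite sets and not containing $\omega$. $F_\sigma$ and $G_{\delta\sigma}$ (countable unions of $G_\delta$ sets) refer to subsets of $\mathcal P(\omega)$ with the Cantor space topology, identifying sets with characteristic functions in $\{0,1\}^\omega$. *)

theory Defs
  imports "HOL-Analysis.Analysis"
begin

definition ideal_on_omega :: "nat set set \<Rightarrow> bool" where
  "ideal_on_omega J \<longleftrightarrow>
     (\<forall>A\<in>J. \<forall>B\<in>J. A \<union> B \<in> J) \<and>
     (\<forall>A\<in>J. \<forall>B. B \<subseteq> A \<longrightarrow> B \<in> J) \<and>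
     (\<forall>A. finite A \<longrightarrow> A \<in> J) \<and>
     UNIV \<notin> J"

text \<open>The Cantor topology on the power set of \<open>\<omega>\<close>, transported from
  \<open>{0,1}\<close> to the \<open>\<omega>\<close> (here \<open>nat \<Rightarrow> bool\<close>, with the product of discrete topologies) along
  the bijection sending a set to its characteristic function.\<close>

definition cantor_topology :: "nat set topology" where
  "cantor_topology =
     pullback_topology UNIV (\<lambda>A n. n \<in> A)
       (product_topology (\<lambda>_::nat. discrete_topology (UNIV::bool set)) UNIV)"

lemma topspace_cantor_topology [simp]: "topspace cantor_topology = UNIV"
  by (auto simp: cantor_topology_def topspace_pullback_topology)

definition gdelta_sigma_in :: "'a topology \<Rightarrow> 'a set \<Rightarrow> bool" where
  "gdelta_sigma_in X = countable union_of gdelta_in X"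

end

theory Submission
  imports Defs
begin

text \<open>
  Call a set positive if it is not in \<open>J\<close>, and write \<open>J\<close> as a countable union of \<open>G\<^sub>\<delta>\<close> sets
  \<open>G n\<close>. The proof finds a positive set \<open>X\<close> such that the trace of \<open>J\<close> on \<open>X\<close> is \<open>F\<^sub>\<sigma>\<close>; then
  \<open>{A. A \<inter> X \<in> J}\<close> is a proper ideal containing \<open>J\<close>, and it is \<open>F\<^sub>\<sigma>\<close> because it is the
  preimage of an \<open>F\<^sub>\<sigma>\<close> set under the continuous map \<open>A \<mapsto> A \<inter> X\<close>.

  Everything rests on one fusion argument (\<open>gdelta_dense_almost_supersets\<close>): if a nonempty
  \<open>G\<^sub>\<delta>\<close> set \<open>G \<subseteq> J\<close> has arbitrarily close to each of its points a point of its closure that almost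
  contains \<open>X\<close>, then two elements of \<open>G\<close> can be built whose union almost contains \<open>X\<close>, so
  \<open>X \<in> J\<close>. This is used twice.

  First, it shows that a \<open>G\<^sub>\<delta>\<close> subset of \<open>J\<close> is nowhere dense in the power set of a positive set.
  Diagonalizing against all \<open>G n\<close>, one gets that every decreasing sequence of positive sets has a
  positive pseudointersection (\<open>positive_pseudointersection\<close>). Hence a single positive set
  can have countably many properties at once, if each of them is inherited by positive almost
  subsets and every positive set has a positive subset with that property
  (\<open>positive_diagonalization\<close>).

  Second, call a family covered relative to \<open>X\<close> if an \<open>F\<^sub>\<sigma>\<close> set containing it has all its traces
  on \<open>X\<close> in \<open>J\<close>. Let \<open>X\<close> be positive and decide, for each of the countably many relatively
  open pieces of the sets \<open>G n\<close> given by cylinders, whether the piece is covered. If some \<open>G n\<close>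
  were not covered relative to \<open>X\<close>, remove from it all covered pieces. What is left is a nonempty
  \<open>G\<^sub>\<delta>\<close> set \<open>H\<close>, and since no positive \<open>Y \<subseteq> X\<close> covers a piece meeting \<open>H\<close>, the closure of each
  piece of \<open>H\<close> has an element with positive trace on \<open>Y\<close>. Shrinking to such traces
  successively, and passing to a pseudointersection, gives a positive \<open>Y\<close> which is almost contained
  in elements of the closures of all pieces of \<open>H\<close>. This contradicts the fusion argument. So every
  \<open>G n\<close>, and with them \<open>J\<close>, is covered relative to \<open>X\<close>.
\<close>

section \<open>Cylinders of the Cantor space\<close>

text \<open>The sets agreeing with \<open>B\<close> below \<open>k\<close> form the basic clopen set of the Cantor space
  determined by the first \<open>k\<close> values of the characteristic function of \<open>B\<close>.\<close>

definition agree_below :: "nat \<Rightarrow> nat set \<Rightarrow> nat set \<Rightarrow> bool" where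
  "agree_below k A B \<longleftrightarrow> (\<forall>x<k. x \<in> A \<longleftrightarrow> x \<in> B)"

lemma agree_below_refl [simp]: "agree_below k A A"
  by (simp add: agree_below_def)

lemma agree_below_sym: "agree_below k A B \<Longrightarrow> agree_below k B A"
  by (simp add: agree_below_def)

lemma agree_below_trans: "agree_below k A B \<Longrightarrow> agree_below k B C \<Longrightarrow> agree_below k A C"
  by (simp add: agree_below_def)

lemma agree_below_mono: "agree_below l A B \<Longrightarrow> k \<le> l \<Longrightarrow> agree_below k A B"
  by (simp add: agree_below_def)

lemma agree_belowD: "agree_below k A B \<Longrightarrow> x < k \<Longrightarrow> x \<in> A \<longleftrightarrow> x \<in> B"
  by (simp add: agree_below_def)

text \<open>There are only countably many cylinders; a finite set representing a cylinder is coded by a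
  list so that it can be enumerated by \<^const>\<open>from_nat\<close>.\<close>

lemma agree_below_finite_list: "\<exists>xs. agree_below k (set xs) S"
proof -
  obtain xs where "set xs = S \<inter> {..<k}"
    using finite_list[of "S \<inter> {..<k}"] by auto
  then show ?thesis by (intro exI[of _ xs]) (simp add: agree_below_def)
qed

lemma openin_cantor_iff:
  "openin cantor_topology U \<longleftrightarrow> (\<forall>A\<in>U. \<exists>k. \<forall>B. agree_below k B A \<longrightarrow> B \<in> U)"
    (is "?L \<longleftrightarrow> ?R")
proof
  assume ?L
  then obtain V where V: "openin (product_topology (\<lambda>_::nat. discrete_topology (UNIV::bool set)) UNIV) V"
    and U: "U = (\<lambda>A n. n \<in> A) -` V"
    by (auto simp: cantor_topology_def openin_pullback_topology)
  show ?R
  proof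
    fix A assume "A \<in> U"
    then have "(\<lambda>n. n \<in> A) \<in> V" using U by auto
    then obtain W where fin: "finite {i. W i \<noteq> (UNIV::bool set)}"
      and A: "(\<lambda>n. n \<in> A) \<in> PiE UNIV W" and WV: "PiE UNIV W \<subseteq> V"
      using V unfolding openin_product_topology_alt by fastforce
    obtain k where k: "\<And>i. W i \<noteq> UNIV \<Longrightarrow> i < k"
      using fin by (metis (mono_tags, lifting) finite_nat_set_iff_bounded mem_Collect_eq)
    have "B \<in> U" if B: "agree_below k B A" for B
    proof -
      have "(i \<in> B) \<in> W i" for i
      proof (cases "i < k")
        case True
        then have "i \<in> B \<longleftrightarrow> i \<in> A" using agree_belowD[OF B] by blast
        then show ?thesis using A by (auto simp: PiE_iff)
      next
        case False
        then show ?thesis using k by auto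
      qed
      then show ?thesis using WV U by (auto simp: PiE_iff)
    qed
    then show "\<exists>k. \<forall>B. agree_below k B A \<longrightarrow> B \<in> U" by blast
  qed
next
  assume R: ?R
  have cyl: "openin cantor_topology {B. agree_below k B A}" for k and A :: "nat set"
  proof -
    let ?W = "\<lambda>n. if n < k then {n \<in> A} else (UNIV::bool set)"
    have "finite {n. ?W n \<noteq> UNIV}"
      by (rule finite_subset[of _ "{..<k}"]) auto
    then have "openin (product_topology (\<lambda>_::nat. discrete_topology (UNIV::bool set)) UNIV) (PiE UNIV ?W)"
      by (auto simp: openin_PiE_gen)
    moreover have "agree_below k B A \<longleftrightarrow> (\<forall>n. (n \<in> B) \<in> ?W n)" for B
      unfolding agree_below_def by auto
    then have "{B. agree_below k B A} = (\<lambda>A n. n \<in> A) -` PiE UNIV ?W \<inter> UNIV"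
      by (simp add: PiE_iff vimage_def)
    ultimately show ?thesis
      unfolding cantor_topology_def openin_pullback_topology by blast
  qed
  show ?L
    unfolding openin_subopen[of _ U]
  proof
    fix A assume "A \<in> U"
    then obtain k where "\<forall>B. agree_below k B A \<longrightarrow> B \<in> U" using R by blast
    then show "\<exists>T. openin cantor_topology T \<and> A \<in> T \<and> T \<subseteq> U"
      using cyl[of k A] by (intro exI[of _ "{B. agree_below k B A}"]) auto
  qed
qed

lemma openin_cantor_depends_below:
  assumes "\<And>A B. agree_below k A B \<Longrightarrow> A \<in> U \<Longrightarrow> B \<in> U"
  shows "openin cantor_topology U"
  unfolding openin_cantor_iff using assms agree_below_sym by blast

lemma in_cantor_closure_of_iff:
  "A \<in> cantor_topology closure_of W \<longleftrightarrow> (\<forall>k. \<exists>S\<in>W. agree_below k S A)"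
proof
  assume A: "A \<in> cantor_topology closure_of W"
  show "\<forall>k. \<exists>S\<in>W. agree_below k S A"
  proof
    fix k
    have "openin cantor_topology {S. agree_below k S A}"
      by (rule openin_cantor_depends_below[of k]) (blast intro: agree_below_trans agree_below_sym)
    moreover have "\<forall>T. A \<in> T \<and> openin cantor_topology T \<longrightarrow> (\<exists>S. S \<in> W \<and> S \<in> T)"
      using A unfolding in_closure_of by simp
    ultimately show "\<exists>S\<in>W. agree_below k S A"
      by (auto dest: spec[of _ "{S. agree_below k S A}"])
  qed
next
  assume R: "\<forall>k. \<exists>S\<in>W. agree_below k S A"
  have "\<exists>S. S \<in> W \<and> S \<in> T" if T: "A \<in> T" "openin cantor_topology T" for T
  proof -
    obtain k where k: "\<And>B. agree_below k B A \<Longrightarrow> B \<in> T"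
      using T unfolding openin_cantor_iff by blast
    then show ?thesis using R by blast
  qed
  then show "A \<in> cantor_topology closure_of W"
    unfolding in_closure_of by simp
qed

lemma limit_of_agreeing_sets:
  fixes C :: "nat \<Rightarrow> nat set" and l :: "nat \<Rightarrow> nat"
  assumes agree: "\<And>n. agree_below (l n) (C (Suc n)) (C n)" and mono: "\<And>n. l n \<le> l (Suc n)"
  obtains L where "\<And>n. agree_below (l n) L (C n)"
proof -
  have le: "l m \<le> l n" if "m \<le> n" for m n
    using that mono by (rule lift_Suc_mono_le[rotated])
  have *: "agree_below (l m) (C n) (C m)" if "m \<le> n" for m n
    using that
  proof (induction n rule: dec_induct)
    case (step n)
    then show ?case
      using agree_below_trans[OF agree_below_mono[OF agree le[OF step(1)]]] by blast
  qed simp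
  define L where "L = (\<Union>n. C n \<inter> {..<l n})"
  have "agree_below (l n) L (C n)" for n
    unfolding agree_below_def
  proof (intro allI impI)
    fix x assume x: "x < l n"
    have "x \<in> C n" if "x \<in> C m" "x < l m" for m
      using agree_belowD[OF *[of m n], of x] agree_belowD[OF *[of n m], of x] that x
      by (cases "m \<le> n") auto
    then show "x \<in> L \<longleftrightarrow> x \<in> C n"
      using x by (auto simp: L_def)
  qed
  then show ?thesis using that by blast
qed

section \<open>Two limits covering a set\<close>

lemma ideal_almost_subset:
  assumes "ideal_on_omega J" "A \<in> J" "finite (X - A)"
  shows "X \<in> J"
proof -
  have "A \<union> (X - A) \<in> J" and sub: "\<And>C D. C \<in> J \<Longrightarrow> D \<subseteq> C \<Longrightarrow> D \<in> J"
    using assms unfolding ideal_on_omega_def by blast+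
  then show ?thesis using sub[of "A \<union> (X - A)" X] by blast
qed

text \<open>A sequence of sets \<open>B n\<close> in the closure of \<open>G\<close> and numbers \<open>k n\<close> is built, with \<open>B n\<close>
  containing \<open>X\<close> from \<open>k n\<close> on, and \<open>B (n + 2)\<close> agreeing with \<open>B n\<close> below \<open>k (n + 1)\<close>. The
  sets with even index and those with odd index then converge, the limits are in \<open>G\<close>, and the block
  of \<open>X\<close> between \<open>k n\<close> and \<open>k (n + 1)\<close> is contained in the limit of the parity of \<open>n\<close>.\<close>

lemma gdelta_dense_almost_supersets:
  assumes J: "ideal_on_omega J" and G: "gdelta_in cantor_topology G" and GJ: "G \<subseteq> J"
    and ne: "A0 \<in> G"
    and dense: "\<And>A k. A \<in> G \<Longrightarrow>
      \<exists>A' \<in> cantor_topology closure_of G. agree_below k A' A \<and> finite (X - A')"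
  shows "X \<in> J"
proof -
  let ?cl = "cantor_topology closure_of G"
  obtain U where U: "\<And>n. openin cantor_topology (U n)" "\<And>n::nat. U (Suc n) \<subseteq> U n" "\<Inter>(range U) = G"
    using G unfolding gdelta_in_descending by metis
  \<comment> \<open>A state holds the two most recent sets \<open>A\<close> and \<open>B\<close>; the next set approximates the older one.\<close>
  define P where "P n = (\<lambda>(A, B, k). A \<in> ?cl \<and> B \<in> ?cl \<and> X - {..<k} \<subseteq> B \<and>
      {S. agree_below k S B} \<subseteq> U n)" for n
  define Q where "Q n = (\<lambda>(A :: nat set, B :: nat set, k :: nat) (A', B', k'). A' = B \<and> k < k' \<and> agree_below k B' A)"
    for n :: nat
  have step: "\<exists>B k'. k < k' \<and> B \<in> ?cl \<and> agree_below k B A \<and> X - {..<k'} \<subseteq> B \<and>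
      {S. agree_below k' S B} \<subseteq> U n" if A: "A \<in> ?cl" for A k n
  proof -
    obtain S where S: "S \<in> G" "agree_below k S A"
      using A unfolding in_cantor_closure_of_iff by blast
    have "S \<in> U n" using S U(3) by blast
    then obtain k1 where k1: "\<And>T. agree_below k1 T S \<Longrightarrow> T \<in> U n"
      using U(1)[of n] unfolding openin_cantor_iff by blast
    define k2 where "k2 = max k k1"
    obtain B where B: "B \<in> ?cl" "agree_below k2 B S" "finite (X - B)"
      using dense[OF S(1)] by blast
    obtain m where m: "X - B \<subseteq> {..<m}"
      using B(3) finite_nat_iff_bounded by blast
    define k' where "k' = max (Suc k) (max k2 m)"
    have "{T. agree_below k' T B} \<subseteq> U n"
    proof safe
      fix T assume "agree_below k' T B"
      then have "agree_below k2 T S"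
        using agree_below_trans[OF agree_below_mono B(2)] k'_def by simp
      then show "T \<in> U n" using k1 agree_below_mono[of k2 T S k1] k2_def by simp
    qed
    moreover have "agree_below k B A"
      using agree_below_trans[OF agree_below_mono[OF B(2)] S(2)] k2_def by simp
    moreover have "X - {..<k'} \<subseteq> B" using m k'_def by auto
    ultimately show ?thesis using B(1) k'_def by (intro exI[of _ B] exI[of _ k']) auto
  qed
  have A0: "A0 \<in> ?cl" using ne agree_below_refl unfolding in_cantor_closure_of_iff by blast
  obtain B0 k0 where "B0 \<in> ?cl" "X - {..<k0} \<subseteq> B0" "{S. agree_below k0 S B0} \<subseteq> U 0"
    using step[OF A0] by metis
  then have "P 0 (A0, B0, k0)" using A0 by (simp add: P_def)
  then have base: "\<exists>x. P 0 x" by blast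
  have "\<exists>y. P (Suc n) y \<and> Q n x y" if "P n x" for n x
  proof -
    obtain A B k where x: "x = (A, B, k)" by (cases x)
    have AB: "A \<in> ?cl" "B \<in> ?cl" using that by (simp_all add: P_def x)
    obtain B' k' where "k < k'" "B' \<in> ?cl" "agree_below k B' A" "X - {..<k'} \<subseteq> B'"
      "{S. agree_below k' S B'} \<subseteq> U (Suc n)"
      using step[OF AB(1), of k "Suc n"] by metis
    then have "P (Suc n) (B, B', k') \<and> Q n x (B, B', k')"
      using AB(2) by (simp add: P_def Q_def x)
    then show ?thesis by blast
  qed
  from dependent_nat_choice[of P Q, OF base this]
  obtain f where f: "\<And>n. P n (f n)" "\<And>n. Q n (f n) (f (Suc n))" by blast
  define B where "B n = fst (snd (f n))" for n
  define k where "k n = snd (snd (f n))" for n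
  have B: "B n \<in> ?cl" "X - {..<k n} \<subseteq> B n" "\<And>S. agree_below (k n) S (B n) \<Longrightarrow> S \<in> U n" for n
    using f(1)[of n] by (auto simp: P_def B_def k_def split: prod.splits)
  have k: "k n < k (Suc n)" for n
    using f(2)[of n] by (auto simp: Q_def k_def split: prod.splits)
  have agree: "agree_below (k (Suc n)) (B (Suc (Suc n))) (B n)" for n
    using f(2)[of n] f(2)[of "Suc n"] by (auto simp: Q_def B_def k_def split: prod.splits)
  have lim: "\<exists>L\<in>G. \<forall>n. agree_below (k (Suc (2*n+d))) L (B (2*n+d))" for d
  proof -
    have mono: "k (Suc (2*n+d)) \<le> k (Suc (2*Suc n+d))" for n
      using k[of "Suc (2*n+d)"] k[of "2 + (2*n+d)"] by simp
    have ag: "agree_below (k (Suc (2*n+d))) (B (2*Suc n+d)) (B (2*n+d))" for n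
      using agree[of "2*n+d"] by simp
    obtain L where L: "\<And>n. agree_below (k (Suc (2*n+d))) L (B (2*n+d))"
      using limit_of_agreeing_sets[of "\<lambda>n. k (Suc (2*n+d))" "\<lambda>n. B (2*n+d)", OF ag mono] by blast
    have "L \<in> U (2*n+d)" for n
      using B(3)[of "2*n+d" L] agree_below_mono[OF L[of n], of "k (2*n+d)"] k[of "2*n+d"] by simp
    moreover have "U (2*n+d) \<subseteq> U n" for n
      using lift_Suc_antimono_le[of U n "2*n+d"] U(2) by auto
    ultimately have "L \<in> G" using U(3) by blast
    then show ?thesis using L by blast
  qed
  obtain L where L: "L \<in> G" "\<And>n. agree_below (k (Suc (2*n))) L (B (2*n))"
    using lim[of 0] by auto
  obtain M where M: "M \<in> G" "\<And>n. agree_below (k (Suc (2*n+1))) M (B (2*n+1))"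
    using lim[of 1] by blast
  \<comment> \<open>Below \<open>k 0\<close> nothing is claimed; any other element of \<open>X\<close> lies in a unique block.\<close>
  have "X - {..<k 0} \<subseteq> L \<union> M"
  proof
    fix x assume x: "x \<in> X - {..<k 0}"
    have "strict_mono k" using k by (rule strict_monoI_Suc)
    then have "x < k (Suc x)" using strict_mono_imp_increasing[of k "Suc x"] by auto
    then have ex: "\<exists>n. x < k n" by blast
    define n where "n = (LEAST n. x < k n)"
    have n: "x < k n" using LeastI_ex[OF ex] by (simp add: n_def)
    then obtain m where m: "n = Suc m" using x by (cases n) auto
    have "\<not> x < k m" using not_less_Least[of m "\<lambda>n. x < k n"] m n_def by auto
    then have xB: "x \<in> B m" using B(2)[of m] x by auto
    show "x \<in> L \<union> M"
    proof (cases "even m")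
      case True
      then obtain j where "m = 2*j" by blast
      then show ?thesis using agree_belowD[OF L(2)[of j], of x] xB n m by simp
    next
      case False
      then obtain j where "m = 2*j+1" using oddE by blast
      then show ?thesis using agree_belowD[OF M(2)[of j], of x] xB n m by simp
    qed
  qed
  then have "finite (X - (L \<union> M))" by (auto intro: finite_subset[of _ "{..<k 0}"])
  moreover have "L \<union> M \<in> J" using J subsetD[OF GJ L(1)] subsetD[OF GJ M(1)] by (simp add: ideal_on_omega_def)
  ultimately show ?thesis using ideal_almost_subset[OF J] by blast
qed

section \<open>Positive pseudointersections\<close>

text \<open>If \<open>G\<close> were dense in the closed set \<open>F\<close> of all \<open>S\<close> that agree with \<open>s\<close> below \<open>k\<close> and are
  contained in \<open>B\<close> above \<open>k\<close>, then the fusion argument would apply to \<open>G \<inter> F\<close>: its closure is \<open>F\<close>, in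
  which the sets almost containing \<open>B\<close> are dense.\<close>

lemma gdelta_nowhere_dense_in_positive:
  assumes J: "ideal_on_omega J" and G: "gdelta_in cantor_topology G" and GJ: "G \<subseteq> J"
    and B: "B \<notin> J"
  shows "\<exists>T k'. k < k' \<and> agree_below k T s \<and> T - {..<k} \<subseteq> B \<and>
    (\<forall>S\<in>G. agree_below k' S T \<longrightarrow> \<not> S - {..<k} \<subseteq> B)"
proof (rule ccontr)
  assume neg: "\<not> ?thesis"
  define F where "F = {S. agree_below k S s \<and> S - {..<k} \<subseteq> B}"
  define H where "H = G \<inter> F"
  have "F = (\<Inter>x. {S. agree_below k S s \<and> (x \<in> S \<longrightarrow> x < k \<or> x \<in> B)})"
    unfolding F_def by auto
  moreover have "gdelta_in cantor_topology {S. agree_below k S s \<and> (x \<in> S \<longrightarrow> x < k \<or> x \<in> B)}" for x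
  proof (intro open_imp_gdelta_in openin_cantor_depends_below[of "max k (Suc x)"])
    fix S T :: "nat set"
    assume ST: "agree_below (max k (Suc x)) S T"
    then have kST: "agree_below k S T" by (rule agree_below_mono) simp
    have "x \<in> S \<longleftrightarrow> x \<in> T" using agree_belowD[OF ST, of x] by simp
    moreover assume "S \<in> {S. agree_below k S s \<and> (x \<in> S \<longrightarrow> x < k \<or> x \<in> B)}"
    ultimately show "T \<in> {S. agree_below k S s \<and> (x \<in> S \<longrightarrow> x < k \<or> x \<in> B)}"
      using agree_below_trans[OF agree_below_sym[OF kST]] by auto
  qed
  ultimately have "gdelta_in cantor_topology F"
    by (auto intro!: gdelta_in_Inter)
  then have H: "gdelta_in cantor_topology H" using G by (simp add: H_def gdelta_in_Int)
  have FH: "F \<subseteq> cantor_topology closure_of H"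
  proof
    fix A assume A: "A \<in> F"
    show "A \<in> cantor_topology closure_of H"
      unfolding in_cantor_closure_of_iff
    proof
      fix i
      define i' where "i' = max i (Suc k)"
      obtain S where S: "S \<in> G" "agree_below i' S A" "S - {..<k} \<subseteq> B"
        proof -
        have "k < i'" "agree_below k A s" "A - {..<k} \<subseteq> B" using A by (auto simp: i'_def F_def)
        then show ?thesis using neg that by blast
      qed
      have "agree_below k S A" "agree_below i S A"
        using agree_below_mono[OF S(2)] i'_def by auto
      moreover from this have "agree_below k S s" using A agree_below_trans F_def by blast
      ultimately show "\<exists>S\<in>H. agree_below i S A" using S unfolding H_def F_def by blast
    qed
  qed
  have "s \<inter> {..<k} \<in> F" by (auto simp: F_def agree_below_def)
  then have "s \<inter> {..<k} \<in> cantor_topology closure_of H" using FH by blast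
  then obtain A0 where "A0 \<in> H" unfolding in_cantor_closure_of_iff by blast
  then have "B \<in> J"
  proof (rule gdelta_dense_almost_supersets[OF J H, rotated])
    show "H \<subseteq> J" using GJ H_def by blast
    fix A j assume A: "A \<in> H"
    define A' where "A' = (A \<inter> {..<max j k}) \<union> (B - {..<max j k})"
    have "A' \<in> F" using A unfolding A'_def F_def H_def by (auto simp: agree_below_def)
    moreover have "agree_below j A' A" by (auto simp: A'_def agree_below_def)
    moreover have "finite (B - A')"
      by (rule finite_subset[of _ "{..<max j k}"]) (auto simp: A'_def)
    ultimately show "\<exists>A'\<in>cantor_topology closure_of H. agree_below j A' A \<and> finite (B - A')"
      using FH by blast
  qed
  with B show False by blast
qed

text \<open>The pseudointersection is a limit of approximations; at step \<open>n\<close> only elements of \<open>B n\<close> are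
  added, in such a way that the limit avoids \<open>G n\<close>.\<close>

lemma positive_pseudointersection:
  assumes J: "ideal_on_omega J" and gds: "gdelta_sigma_in cantor_topology J"
    and pos: "\<And>i. B i \<notin> J" and anti: "\<And>i::nat. B (Suc i) \<subseteq> B i"
  obtains X where "X \<notin> J" "\<And>i. finite (X - B i)"
proof -
  obtain G where G: "\<And>n::nat. gdelta_in cantor_topology (G n)" and JG: "\<Union>(range G) = J"
    using gds unfolding gdelta_sigma_in_def
    by (subst (asm) countable_union_of_explicit) auto
  \<comment> \<open>A state \<open>(s, k)\<close> prescribes the limit below \<open>k\<close>. No invariant is needed, only the transition.\<close>
  define P where "P = (\<lambda>(n::nat) (x :: nat set \<times> nat). True)"
  define Q where "Q n = (\<lambda>(s, k) (T, k'). k < k' \<and> agree_below k T s \<and> T - {..<k} \<subseteq> B n \<and>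
    (\<forall>S\<in>G n. agree_below k' S T \<longrightarrow> \<not> S - {..<k} \<subseteq> B n))" for n
  have "\<exists>y. P (Suc n) y \<and> Q n x y" for n x
  proof (cases x)
    case (Pair s k)
    have "G n \<subseteq> J" using JG by blast
    from gdelta_nowhere_dense_in_positive[OF J G this pos, of k s n]
    show ?thesis unfolding P_def Q_def Pair by simp
  qed
  then obtain f where f: "\<And>n. Q n (f n) (f (Suc n))"
    using dependent_nat_choice[of P Q] unfolding P_def by blast
  define s where "s n = fst (f n)" for n
  define k where "k n = snd (f n)" for n
  have k: "k n < k (Suc n)" and agree: "agree_below (k n) (s (Suc n)) (s n)"
    and sub: "s (Suc n) - {..<k n} \<subseteq> B n"
    and avoid: "\<And>S. S \<in> G n \<Longrightarrow> agree_below (k (Suc n)) S (s (Suc n)) \<Longrightarrow> \<not> S - {..<k n} \<subseteq> B n"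
    for n
    using f[of n] by (auto simp: Q_def s_def k_def split: prod.splits)
  obtain X where X: "\<And>n. agree_below (k n) X (s n)"
    using limit_of_agreeing_sets[of k s, OF agree less_imp_le[OF k]] by blast
  have B: "B m \<subseteq> B n" if "n \<le> m" for m n
    using lift_Suc_antimono_le[of B n m] anti that by blast
  have km: "strict_mono k" using k by (rule strict_monoI_Suc)
  have tail: "X - {..<k n} \<subseteq> B n" for n
  proof
    fix x assume x: "x \<in> X - {..<k n}"
    have "x < k (Suc x)" using strict_mono_imp_increasing[OF km, of "Suc x"] by auto
    then have ex: "\<exists>m. x < k m" by blast
    define m where "m = (LEAST m. x < k m)"
    have m: "x < k m" using LeastI_ex[OF ex] by (simp add: m_def)
    have "n < m"
      using m x strict_mono_less[OF km] by (metis DiffD2 lessThan_iff linorder_not_less order_less_le_trans strict_mono_less_eq[OF km])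
    then obtain i where i: "m = Suc i" "n \<le> i" by (cases m) auto
    have "\<not> x < k i" using not_less_Least[of i "\<lambda>m. x < k m"] i m_def by auto
    moreover have "x \<in> s (Suc i)" using agree_belowD[OF X[of "Suc i"], of x] x m i by simp
    ultimately have "x \<in> B i" using sub[of i] by auto
    then show "x \<in> B n" using B[OF i(2)] by blast
  qed
  have "X \<notin> G n" for n
    using avoid[of X n] X tail by blast
  then have "X \<notin> J" using JG by blast
  moreover have "finite (X - B n)" for n
  proof (rule finite_subset)
    show "X - B n \<subseteq> {..<k n}" using tail[of n] by blast
  qed simp
  ultimately show ?thesis using that by blast
qed

lemma positive_diagonalization:
  assumes J: "ideal_on_omega J" and gds: "gdelta_sigma_in cantor_topology J"
    and pos: "Y \<notin> J"
    and extend: "\<And>(i::nat) X. X \<subseteq> Y \<Longrightarrow> X \<notin> J \<Longrightarrow> \<exists>X'\<subseteq>X. X' \<notin> J \<and> \<Phi> i X'"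
    and hered: "\<And>i X X'. \<Phi> i X \<Longrightarrow> finite (X' - X) \<Longrightarrow> X' \<notin> J \<Longrightarrow> \<Phi> i X'"
  shows "\<exists>X\<subseteq>Y. X \<notin> J \<and> (\<forall>i. \<Phi> i X)"
proof -
  have "\<exists>x. x \<subseteq> Y \<and> x \<notin> J" using pos by blast
  moreover have "\<exists>y. (y \<subseteq> Y \<and> y \<notin> J) \<and> y \<subseteq> x \<and> \<Phi> n y" if "x \<subseteq> Y \<and> x \<notin> J" for x n
    using extend[of x n] that by blast
  ultimately have "\<exists>f. \<forall>n::nat. (f n \<subseteq> Y \<and> f n \<notin> J) \<and> f (Suc n) \<subseteq> f n \<and> \<Phi> n (f (Suc n))"
    by (rule dependent_nat_choice[of "\<lambda>_ x. x \<subseteq> Y \<and> x \<notin> J" "\<lambda>n x y. y \<subseteq> x \<and> \<Phi> n y"])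
  then obtain f where f: "\<And>n. f n \<subseteq> Y" "\<And>n. f n \<notin> J" "\<And>n. f (Suc n) \<subseteq> f n" "\<And>n. \<Phi> n (f (Suc n))"
    by blast
  obtain X where X: "X \<notin> J" "\<And>i. finite (X - f i)"
    using positive_pseudointersection[OF J gds, of f] f by blast
  have fin: "finite (X \<inter> f 0 - f i)" for i
    using X(2)[of i] by (rule finite_subset[rotated]) auto
  have "X - (X \<inter> f 0) = X - f 0" by blast
  then have "X \<inter> f 0 \<notin> J" using X ideal_almost_subset[OF J, of "X \<inter> f 0" X] by metis
  then show ?thesis
    using f(1)[of 0] hered[OF f(4) fin] by (intro exI[of _ "X \<inter> f 0"]) blast
qed

section \<open>Covering by \<open>F\<^sub>\<sigma>\<close> sets with traces in the ideal\<close>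

text \<open>\<open>W\<close> is covered relative to \<open>X\<close> if it can be enlarged to an \<open>F\<^sub>\<sigma>\<close> set without
  introducing a set whose trace on \<open>X\<close> is positive. The smaller \<open>X\<close> is, modulo finite sets, the
  weaker the condition.\<close>

definition fsigma_covered :: "nat set set \<Rightarrow> nat set \<Rightarrow> nat set set \<Rightarrow> bool" where
  "fsigma_covered J X W \<longleftrightarrow>
     (\<exists>F. fsigma_in cantor_topology F \<and> W \<subseteq> F \<and> (\<forall>A\<in>F. A \<inter> X \<in> J))"

lemma fsigma_covered_subset:
  "fsigma_covered J X W \<Longrightarrow> W' \<subseteq> W \<Longrightarrow> fsigma_covered J X W'"
  unfolding fsigma_covered_def by blast

lemma fsigma_covered_almost_subset:
  assumes J: "ideal_on_omega J" and "fsigma_covered J X W" "finite (X' - X)"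
  shows "fsigma_covered J X' W"
proof -
  have "A \<inter> X' \<in> J" if "A \<inter> X \<in> J" for A
    using that
    by (rule ideal_almost_subset[OF J]) (rule finite_subset[OF _ assms(3)], blast)
  then show ?thesis using assms(2) unfolding fsigma_covered_def by blast
qed

lemma fsigma_covered_Union:
  assumes "countable \<W>" and "\<And>W. W \<in> \<W> \<Longrightarrow> fsigma_covered J X W"
  shows "fsigma_covered J X (\<Union>\<W>)"
proof -
  obtain F where F: "\<And>W. W \<in> \<W> \<Longrightarrow>
      fsigma_in cantor_topology (F W) \<and> W \<subseteq> F W \<and> (\<forall>A\<in>F W. A \<inter> X \<in> J)"
    using assms(2) unfolding fsigma_covered_def by metis
  have "fsigma_in cantor_topology (\<Union>(F ` \<W>))"
    using assms(1) F by (intro fsigma_in_Union) auto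
  then show ?thesis unfolding fsigma_covered_def
    using F by (intro exI[of _ "\<Union>(F ` \<W>)"]) blast
qed

text \<open>The assumption \<open>decided\<close> says that shrinking \<open>X\<close> to a positive subset does not make new
  cylinder pieces of \<open>G\<close> covered. The set \<open>H\<close> of points of \<open>G\<close> without a covered cylinder
  neighbourhood is again \<open>G\<^sub>\<delta>\<close>, and it must be empty.\<close>

lemma gdelta_fsigma_covered:
  assumes J: "ideal_on_omega J" and gds: "gdelta_sigma_in cantor_topology J"
    and G: "gdelta_in cantor_topology G" and GJ: "G \<subseteq> J" and X: "X \<notin> J"
    and decided: "\<And>k S Y. Y \<subseteq> X \<Longrightarrow> Y \<notin> J \<Longrightarrow> fsigma_covered J Y {T \<in> G. agree_below k T S} \<Longrightarrow>
      fsigma_covered J X {T \<in> G. agree_below k T S}"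
  shows "fsigma_covered J X G"
proof -
  define piece where "piece k S = {T \<in> G. agree_below k T S}" for k and S :: "nat set"
  define H where "H = {S \<in> G. \<forall>k. \<not> fsigma_covered J X (piece k S)}"
  have piece_cong: "piece k S = piece k T" if "agree_below k S T" for k S T
    unfolding piece_def using that agree_below_trans agree_below_sym by blast
  have "H = G \<inter> (\<Inter>k. {S. \<not> fsigma_covered J X (piece k S)})"
    by (auto simp: H_def)
  moreover have "openin cantor_topology {S. \<not> fsigma_covered J X (piece k S)}" for k
    by (rule openin_cantor_depends_below[of k]) (metis piece_cong mem_Collect_eq)
  then have "gdelta_in cantor_topology (\<Inter>k. {S. \<not> fsigma_covered J X (piece k S)})"
    by (intro gdelta_in_Inter) (auto intro: open_imp_gdelta_in)
  ultimately have H: "gdelta_in cantor_topology H"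
    using gdelta_in_Int[OF G] by simp
  let ?\<W> = "{W \<in> (\<Union>k. range (piece k)). fsigma_covered J X W}"
  have "range (piece k) \<subseteq> range (\<lambda>xs. piece k (set xs))" for k
    using agree_below_finite_list[of k] piece_cong by (smt (verit, best) image_subset_iff rangeI)
  then have "countable (range (piece k))" for k
    by (rule countable_subset) simp
  then have "countable ?\<W>" by (intro countable_Collect countable_UN) auto
  then have "fsigma_covered J X (\<Union>?\<W>)" by (rule fsigma_covered_Union) blast
  moreover have "G - H \<subseteq> \<Union>?\<W>"
  proof
    fix S assume S: "S \<in> G - H"
    then obtain k where "fsigma_covered J X (piece k S)" by (auto simp: H_def)
    moreover have "S \<in> piece k S" using S by (simp add: piece_def)
    ultimately show "S \<in> \<Union>?\<W>" by blast
  qed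
  ultimately have rest: "fsigma_covered J X (G - H)" by (rule fsigma_covered_subset)
  show ?thesis
  proof (cases "H = {}")
    case True
    then show ?thesis using rest by simp
  next
    case False
    then obtain A0 where A0: "A0 \<in> H" by blast
    have HJ: "H \<subseteq> J" using GJ H_def by blast
    define V where "V = (\<lambda>(k, xs). {T \<in> H. agree_below k T (set xs)})"
    define \<Phi> where "\<Phi> i Y \<longleftrightarrow>
        (V (from_nat i) \<noteq> {} \<longrightarrow> (\<exists>A\<in>cantor_topology closure_of V (from_nat i). finite (Y - A)))" for i Y
    have extend: "\<exists>Y'\<subseteq>Y. Y' \<notin> J \<and> \<Phi> i Y'" if Y: "Y \<subseteq> X" "Y \<notin> J" for i Y
    proof (cases "V (from_nat i) = {}")
      case True
      then show ?thesis using Y \<Phi>_def by blast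
    next
      case False
      obtain k :: nat and xs :: "nat list" where kxs: "from_nat i = (k, xs)" by fastforce
      define V' where "V' = V (from_nat i)"
      obtain S where S: "S \<in> V'" using False V'_def by blast
      have V'_eq: "V' = piece k S \<inter> H"
      proof -
        have S': "S \<in> H" "agree_below k S (set xs)" using S by (auto simp: V'_def V_def kxs)
        have "agree_below k T (set xs) \<longleftrightarrow> agree_below k T S" for T
          using S'(2) agree_below_trans agree_below_sym by blast
        then show ?thesis by (auto simp: V'_def V_def kxs piece_def H_def)
      qed
      \<comment> \<open>Otherwise the closure of \<open>V'\<close>, together with a cover of \<open>G - H\<close>, covers a piece meeting \<open>H\<close>.\<close>
      have "\<exists>A\<in>cantor_topology closure_of V'. A \<inter> Y \<notin> J"
      proof (rule ccontr)
        assume "\<not> ?thesis"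
        then have 1: "fsigma_covered J Y (cantor_topology closure_of V')"
          unfolding fsigma_covered_def using closed_imp_fsigma_in[OF closedin_closure_of] by blast
        have 2: "fsigma_covered J Y (G - H)"
          using rest by (rule fsigma_covered_almost_subset[OF J]) (use Y in \<open>simp add: Diff_eq_empty_iff[THEN iffD2]\<close>)
        have "fsigma_covered J Y (\<Union>{cantor_topology closure_of V', G - H})"
          by (rule fsigma_covered_Union) (use 1 2 in auto)
        moreover have "piece k S \<subseteq> \<Union>{cantor_topology closure_of V', G - H}"
          using closure_of_subset[of V' cantor_topology] by (auto simp: V'_eq piece_def)
        ultimately have "fsigma_covered J Y (piece k S)" by (rule fsigma_covered_subset)
        then have "fsigma_covered J X (piece k S)"
          using decided[OF Y] unfolding piece_def by blast
        then show False using S unfolding V'_eq H_def by blast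
      qed
      then obtain A where A: "A \<in> cantor_topology closure_of V'" "A \<inter> Y \<notin> J" by blast
      have "finite (A \<inter> Y - A)" by (rule finite_subset[of _ "{}"]) auto
      then have "\<Phi> i (A \<inter> Y)" using A unfolding \<Phi>_def V'_def by blast
      then show ?thesis using A(2) by blast
    qed
    have hered: "\<Phi> i Y'" if "\<Phi> i Y" "finite (Y' - Y)" "Y' \<notin> J" for i Y Y'
    proof -
      have "finite (Y' - A)" if "finite (Y - A)" for A
        by (rule finite_subset[of _ "(Y - A) \<union> (Y' - Y)"]) (use that \<open>finite (Y' - Y)\<close> in auto)
      then show ?thesis using that(1) unfolding \<Phi>_def by blast
    qed
    have "\<exists>Y\<subseteq>X. Y \<notin> J \<and> (\<forall>i. \<Phi> i Y)"
      using extend hered by (rule positive_diagonalization[OF J gds X])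
    then obtain Y where Y: "Y \<subseteq> X" "Y \<notin> J" "\<And>i. \<Phi> i Y" by blast
    have "Y \<in> J"
    proof (rule gdelta_dense_almost_supersets[OF J H HJ A0])
      fix A k assume A: "A \<in> H"
      obtain xs where xs: "agree_below k (set xs) A"
        using agree_below_finite_list by blast
      have "A \<in> V (k, xs)" using A agree_below_sym[OF xs] by (simp add: V_def)
      then obtain A' where A': "A' \<in> cantor_topology closure_of V (k, xs)" "finite (Y - A')"
        using Y(3)[of "to_nat (k, xs)"] unfolding \<Phi>_def by auto
      have "V (k, xs) \<subseteq> H" by (auto simp: V_def)
      then have "A' \<in> cantor_topology closure_of H" using A' closure_of_mono by blast
      moreover have "agree_below k A' A"
      proof -
        obtain T where "T \<in> V (k, xs)" "agree_below k T A'"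
          using A'(1) unfolding in_cantor_closure_of_iff by blast
        then show ?thesis
          using agree_below_trans[OF agree_below_sym agree_below_trans[OF _ xs]] by (auto simp: V_def)
      qed
      ultimately show "\<exists>A'\<in>cantor_topology closure_of H. agree_below k A' A \<and> finite (Y - A')"
        using A' by blast
    qed
    then show ?thesis using Y(2) by blast
  qed
qed

lemma locally_fsigma_covered:
  assumes J: "ideal_on_omega J" and gds: "gdelta_sigma_in cantor_topology J"
  obtains X where "X \<notin> J" "fsigma_covered J X J"
proof -
  obtain G where G: "\<And>n::nat. gdelta_in cantor_topology (G n)" and JG: "\<Union>(range G) = J"
    using gds unfolding gdelta_sigma_in_def
    by (subst (asm) countable_union_of_explicit) auto
  define V where "V = (\<lambda>(n, k, xs). {T \<in> G n. agree_below k T (set xs)})"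
  define \<Phi> where "\<Phi> i X \<longleftrightarrow> fsigma_covered J X (V (from_nat i)) \<or>
      (\<forall>Y\<subseteq>X. Y \<notin> J \<longrightarrow> \<not> fsigma_covered J Y (V (from_nat i)))" for i X
  have extend: "\<exists>X'\<subseteq>X. X' \<notin> J \<and> \<Phi> i X'" if "X \<subseteq> UNIV" "X \<notin> J" for i X
    using that(2) unfolding \<Phi>_def by blast
  have hered: "\<Phi> i X'" if \<Phi>: "\<Phi> i X" and fin: "finite (X' - X)" and "X' \<notin> J" for i X X'
  proof (cases "fsigma_covered J X (V (from_nat i))")
    case True
    then show ?thesis using fsigma_covered_almost_subset[OF J _ fin] \<Phi>_def by blast
  next
    case False
    have "\<not> fsigma_covered J Y (V (from_nat i))" if Y: "Y \<subseteq> X'" "Y \<notin> J" for Y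
    proof
      assume "fsigma_covered J Y (V (from_nat i))"
      then have "fsigma_covered J (Y \<inter> X) (V (from_nat i))"
        by (rule fsigma_covered_almost_subset[OF J]) (simp add: Diff_eq_empty_iff[THEN iffD2])
      moreover have "finite (Y - (Y \<inter> X))"
        by (rule finite_subset[OF _ fin]) (use Y in blast)
      then have "Y \<inter> X \<notin> J" using ideal_almost_subset[OF J] Y by blast
      ultimately show False using \<Phi> False unfolding \<Phi>_def by blast
    qed
    then show ?thesis unfolding \<Phi>_def by blast
  qed
  have UNIV: "UNIV \<notin> J" using J ideal_on_omega_def by blast
  have "\<exists>X\<subseteq>UNIV. X \<notin> J \<and> (\<forall>i. \<Phi> i X)"
    using extend hered by (rule positive_diagonalization[OF J gds UNIV])
  then obtain X where X: "X \<notin> J" "\<And>i. \<Phi> i X" by blast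
  have "fsigma_covered J X (G n)" for n
  proof (rule gdelta_fsigma_covered[OF J gds G _ X(1)])
    show "G n \<subseteq> J" using JG by blast
    fix k S Y
    assume Y: "Y \<subseteq> X" "Y \<notin> J" "fsigma_covered J Y {T \<in> G n. agree_below k T S}"
    obtain xs where xs: "agree_below k (set xs) S"
      using agree_below_finite_list by blast
    have "agree_below k T (set xs) \<longleftrightarrow> agree_below k T S" for T
      using xs agree_below_trans agree_below_sym by blast
    then have "V (n, k, xs) = {T \<in> G n. agree_below k T S}" by (simp add: V_def)
    then show "fsigma_covered J X {T \<in> G n. agree_below k T S}"
      using X(2)[of "to_nat (n, k, xs)"] Y unfolding \<Phi>_def by auto
  qed
  then have "fsigma_covered J X (\<Union>(range G))" by (intro fsigma_covered_Union) auto
  then show ?thesis using that X(1) JG by simp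
qed

text \<open>The map \<open>A \<mapsto> A \<inter> X\<close> is continuous.\<close>

lemma fsigma_in_cantor_trace:
  assumes "fsigma_in cantor_topology F"
  shows "fsigma_in cantor_topology {A. A \<inter> X \<in> F}"
proof -
  obtain C where C: "\<And>n::nat. closedin cantor_topology (C n)" "\<Union>(range C) = F"
    using assms unfolding fsigma_in_ascending by blast
  have "closedin cantor_topology {A. A \<inter> X \<in> C n}" for n
  proof -
    have o: "openin cantor_topology (- C n)" using C(1)[of n] by (simp add: closedin_def Compl_eq_Diff_UNIV)
    have "openin cantor_topology {A. A \<inter> X \<in> - C n}"
      unfolding openin_cantor_iff
    proof
      fix A assume "A \<in> {A. A \<inter> X \<in> - C n}"
      then obtain k where k: "\<And>B. agree_below k B (A \<inter> X) \<Longrightarrow> B \<in> - C n"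
        using o unfolding openin_cantor_iff by blast
      have "B \<inter> X \<in> - C n" if "agree_below k B A" for B
        by (rule k) (use that in \<open>simp add: agree_below_def\<close>)
      then show "\<exists>k. \<forall>B. agree_below k B A \<longrightarrow> B \<in> {A. A \<inter> X \<in> - C n}" by blast
    qed
    moreover have "UNIV - {A. A \<inter> X \<in> C n} = {A. A \<inter> X \<in> - C n}" by auto
    ultimately show ?thesis by (simp add: closedin_def)
  qed
  then have "fsigma_in cantor_topology (\<Union>n. {A. A \<inter> X \<in> C n})"
    by (intro fsigma_in_Union) (auto intro: closed_imp_fsigma_in)
  moreover have "(\<Union>n. {A. A \<inter> X \<in> C n}) = {A. A \<inter> X \<in> F}" using C(2) by auto
  ultimately show ?thesis by simp
qed

theorem proposition10p1:
  fixes J :: "nat set set"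
  assumes "ideal_on_omega J"
    and "gdelta_sigma_in cantor_topology J"
  shows "\<exists>J'. ideal_on_omega J' \<and> fsigma_in cantor_topology J' \<and> J \<subseteq> J'"
proof -
  obtain X F where X: "X \<notin> J" and F: "fsigma_in cantor_topology F" "J \<subseteq> F" "\<And>A. A \<in> F \<Longrightarrow> A \<inter> X \<in> J"
    using locally_fsigma_covered[OF assms] unfolding fsigma_covered_def by metis
  have union: "\<And>A B. A \<in> J \<Longrightarrow> B \<in> J \<Longrightarrow> A \<union> B \<in> J" and sub: "\<And>A B. A \<in> J \<Longrightarrow> B \<subseteq> A \<Longrightarrow> B \<in> J"
    and fin: "\<And>A. finite A \<Longrightarrow> A \<in> J"
    using assms(1) unfolding ideal_on_omega_def by blast+
  define J' where "J' = {A. A \<inter> X \<in> J}"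
  \<comment> \<open>\<open>F\<close> need not be contained in \<open>J\<close>, but both contain the same subsets of \<open>X\<close>.\<close>
  have "A \<inter> X \<in> J \<longleftrightarrow> A \<inter> X \<in> F" for A
    using F(2) F(3)[of "A \<inter> X"] by (auto simp: Int_assoc)
  then have "fsigma_in cantor_topology J'"
    using fsigma_in_cantor_trace[OF F(1), of X] by (simp add: J'_def)
  moreover have "ideal_on_omega J'"
    unfolding ideal_on_omega_def
  proof (intro conjI ballI allI impI)
    fix A B assume "A \<in> J'" "B \<in> J'"
    then show "A \<union> B \<in> J'" using union by (simp add: J'_def Int_Un_distrib2)
  next
    fix A B assume "A \<in> J'" "B \<subseteq> A"
    then show "B \<in> J'" using sub[of "A \<inter> X" "B \<inter> X"] by (auto simp: J'_def)
  qed (use X fin in \<open>auto simp: J'_def\<close>)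
  moreover have "J \<subseteq> J'" using sub by (auto simp: J'_def)
  ultimately show ?thesis by blast
qed

end
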